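(* Let $T\ge 1$, let $\mathbf{x}_1,\dots,\mathbf{x}_T\in\mathbb{R}^n$ and $B\in\mathbb{R}$. Let the uncertain vectors satisfy $\mathbf{d}_1\in\mathcal{U}_1$ and $\mathbf{d}_t\in\mathcal{U}_t(\mathbf{d}_{t-1})$ for $t=2,\dots,T$, where $$\mathcal{U}_t(\mathbf{d}_{t-1})=\{\mathbf{d}_t \mid \mathbf{d}_t=\boldsymbol{\mu}_t(\mathbf{d}_{t-1})+\mathbf{L}_t\mathbf{u}_t,\ \|\mathbf{u}_t\|_2\le r_t\},$$ with $\boldsymbol{\mu}_1$ a given constant vector (so $\mathcal{U}_1=\{\boldsymbol{\mu}_1+\mathbf{L}_1\mathbf{u}_1 : \|\mathbf{u}_1\|_2\le r_1\}$) and with centers updated by $$\boldsymbol{\mu}_{t+1}(\mathbf{d}_t)=\mathbf{A}_t\,\boldsymbol{\mu}_t(\mathbf{d}_{t-1})+\mathbf{F}_t\mathbf{d}_t+\mathbf{c}_t,\qquad t=1,\dots,T-1.$$ Define $\mathbf{y}_T=\mathbf{x}_T$, $C_T=0$, $R_T=r_T\|\mathbf{L}_T^\top\mathbf{x}_T\|_2$, and for $k=T-1,\dots,1$ $$\mathbf{y}_k=\mathbf{x}_k+(\mathbf{F}_k+\mathbf{A}_k)^\top\mathbf{y}_{k+1},\quad C_k=\mathbf{c}_k^\top\mathbf{y}_{k+1}+C_{k+1},\quad R_k=r_k\|\mathbf{L}_k^\top(\mathbf{x}_k+\mathbf{F}_k^\top\mathbf{y}_{k+1})\|_2+R_{k+1}.$$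 Then the robust constraint $$\sum_{t=1}^T\mathbf{d}_t^\top\mathbf{x}_t\le B\quad\text{for all } \mathbf{d}_1\in\mathcal{U}_1 \text{ and all } \mathbf{d}_t\in\mathcal{U}_t(\mathbf{d}_{t-1}),\ t=2,\dots,T,$$ holds if and only if $$\boldsymbol{\mu}_1^\top\mathbf{y}_1+C_1+R_1\le B.$$
   Context: All decisions $\mathbf{x}_t$ are here-and-now (fixed vectors not depending on the uncertainty). For each $t$: $r_t\ge 0$ is a constant radius; $\mathbf{L}_t$ is a constant matrix with $\mathbf{L}_t\mathbf{L}_t^\top=\boldsymbol{\Sigma}_t$ for a given covariance matrix $\boldsymbol{\Sigma}_t$; $\mathbf{A}_t,\mathbf{F}_t\in\mathbb{R}^{n\times n}$ and $\mathbf{c}_t\in\mathbb{R}^n$ are constants. The notation $\boldsymbol{\mu}_t(\mathbf{d}_{t-1})$ denotes the center of the set at period $t$ obtained by running the recursion along the realized trajectory $\mathbf{d}_1,\dots,\mathbf{d}_{t-1}$. The "robust counterpart" of a constraint that must hold for all uncertainty realizations is an equivalent deterministic constraint. *)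

theory Defs
  imports "HOL-Analysis.Analysis"
begin

definition covariance_matrix :: "real ^ 'n ^ 'n \<Rightarrow> bool" where
  "covariance_matrix S \<longleftrightarrow> transpose S = S \<and> (\<forall>v. 0 \<le> v \<bullet> (S *v v))"

(* Periods are numbered from 1; the value at 0 is a dummy.
   center A F c mu1 d t depends on the trajectory d only through d 1, ..., d (t - 1). *)
primrec center ::
  "(nat \<Rightarrow> real ^ 'n ^ 'n) \<Rightarrow> (nat \<Rightarrow> real ^ 'n ^ 'n) \<Rightarrow> (nat \<Rightarrow> real ^ 'n) \<Rightarrow>
   real ^ 'n \<Rightarrow> (nat \<Rightarrow> real ^ 'n) \<Rightarrow> nat \<Rightarrow> real ^ 'n" where
  "center A F c mu1 d 0 = mu1"
| "center A F c mu1 d (Suc t) =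
     (if t = 0 then mu1 else A t *v center A F c mu1 d t + F t *v d t + c t)"

definition uncertainty_set ::
  "(nat \<Rightarrow> real ^ 'n ^ 'n) \<Rightarrow> (nat \<Rightarrow> real ^ 'n ^ 'n) \<Rightarrow> (nat \<Rightarrow> real ^ 'n) \<Rightarrow>
   real ^ 'n \<Rightarrow> (nat \<Rightarrow> real ^ 'm ^ 'n) \<Rightarrow> (nat \<Rightarrow> real) \<Rightarrow>
   (nat \<Rightarrow> real ^ 'n) \<Rightarrow> nat \<Rightarrow> (real ^ 'n) set" where
  "uncertainty_set A F c mu1 L r d t =
     {center A F c mu1 d t + L t *v u | u. norm u \<le> r t}"

(* Backward recursions from the horizon T; values at k > T are dummies. *)
function yvec ::
  "nat \<Rightarrow> (nat \<Rightarrow> real ^ 'n ^ 'n) \<Rightarrow> (nat \<Rightarrow> real ^ 'n ^ 'n) \<Rightarrow> (nat \<Rightarrow> real ^ 'n) \<Rightarrow>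
   nat \<Rightarrow> real ^ 'n" where
  "yvec T A F x k =
     (if k < T then x k + transpose (F k + A k) *v yvec T A F x (Suc k) else x k)"
  by pat_completeness auto
termination
  by (relation "Wellfounded.measure (\<lambda>(T, A, F, x, k). T - k)") auto

function Cval ::
  "nat \<Rightarrow> (nat \<Rightarrow> real ^ 'n ^ 'n) \<Rightarrow> (nat \<Rightarrow> real ^ 'n ^ 'n) \<Rightarrow> (nat \<Rightarrow> real ^ 'n) \<Rightarrow>
   (nat \<Rightarrow> real ^ 'n) \<Rightarrow> nat \<Rightarrow> real" where
  "Cval T A F c x k =
     (if k < T then c k \<bullet> yvec T A F x (Suc k) + Cval T A F c x (Suc k) else 0)"
  by pat_completeness auto
termination
  by (relation "Wellfounded.measure (\<lambda>(T, A, F, c, x, k). T - k)") auto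

function Rval ::
  "nat \<Rightarrow> (nat \<Rightarrow> real ^ 'n ^ 'n) \<Rightarrow> (nat \<Rightarrow> real ^ 'n ^ 'n) \<Rightarrow> (nat \<Rightarrow> real ^ 'm ^ 'n) \<Rightarrow>
   (nat \<Rightarrow> real) \<Rightarrow> (nat \<Rightarrow> real ^ 'n) \<Rightarrow> nat \<Rightarrow> real" where
  "Rval T A F L r x k =
     (if k < T
      then r k * norm (transpose (L k) *v (x k + transpose (F k) *v yvec T A F x (Suc k)))
             + Rval T A F L r x (Suc k)
      else r k * norm (transpose (L k) *v x k))"
  by pat_completeness auto
termination
  by (relation "Wellfounded.measure (\<lambda>(T, A, F, L, r, x, k). T - k)") auto

declare yvec.simps [simp del] Cval.simps [simp del] Rval.simps [simp del]

end

theory Submission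
  imports Defs
begin

text \<open>Unrolling the centers along a trajectory with perturbations \<open>u\<^sub>t\<close> turns the total cost into
  the constant \<open>\<mu>\<^sub>1 \<bullet> y\<^sub>1 + C\<^sub>1\<close> plus terms \<open>u\<^sub>t \<bullet> L\<^sub>t\<^sup>T z\<^sub>t\<close>, where \<open>z\<^sub>t\<close> collects the direct and the
  propagated effect of \<open>d\<^sub>t\<close>. The \<open>u\<^sub>t\<close> range independently over balls, so the supremum
  is the sum of the dual norms \<open>r\<^sub>t * norm (L\<^sub>t\<^sup>T z\<^sub>t)\<close>, and it is attained.\<close>

lemma inner_transpose_mult_vec:
  fixes M :: "real ^ 'm ^ 'n"
  shows "v \<bullet> (transpose M *v w) = (M *v v) \<bullet> w"
  by (metis dot_lmul_matrix inner_commute transpose_matrix_vector)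

text \<open>The equation for \<open>d\<close> is only apparently circular: the center at
  \<open>t\<close> depends on earlier values of \<open>d\<close> alone, so arbitrary perturbations
  \<open>u\<close> can be realized.\<close>

lemma exists_trajectory:
  fixes L :: "nat \<Rightarrow> real ^ 'm ^ 'n"
  shows "\<exists>d. \<forall>t. d t = center A F c mu1 d t + L t *v u t"
proof -
  \<comment> \<open>This is the recursion of \<open>center\<close> with the value of
    \<open>d t\<close> substituted, so \<open>d\<close> no longer occurs in it.\<close>
  define m where "m = rec_nat mu1 (\<lambda>t v. if t = 0 then mu1 else
    A t *v v + F t *v (v + L t *v u t) + c t)"
  define d where "d = (\<lambda>t. m t + L t *v u t)"
  have "center A F c mu1 d t = m t" for t
    by (induction t) (simp_all add: m_def d_def)
  then show ?thesis
    by (intro exI[of _ d]) (simp add: d_def)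
qed

definition zvec ::
  "nat \<Rightarrow> (nat \<Rightarrow> real ^ 'n ^ 'n) \<Rightarrow> (nat \<Rightarrow> real ^ 'n ^ 'n) \<Rightarrow> (nat \<Rightarrow> real ^ 'n) \<Rightarrow>
   nat \<Rightarrow> real ^ 'n" where
  "zvec T A F x k =
     (if k < T then x k + transpose (F k) *v yvec T A F x (Suc k) else x k)"

lemma Rval_eq_sum:
  assumes "k \<le> T"
  shows "Rval T A F L r x k = (\<Sum>t = k..T. r t * norm (transpose (L t) *v zvec T A F x t))"
  using assms
proof (induction k rule: inc_induct)
  case base
  then show ?case by (simp add: Rval.simps zvec_def)
next
  case (step k)
  then show ?case
    by (subst Rval.simps) (simp add: sum.atLeast_Suc_atMost[of k T] zvec_def)
qed

text \<open>A vector added to both the center and the demand of period \<open>k\<close> acts in two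
  ways: through the demand, with weight \<open>zvec\<close>, and through \<open>A k\<close> on the
  next center.\<close>

lemma inner_yvec:
  assumes "k < T"
  shows "v \<bullet> yvec T A F x k =
    v \<bullet> zvec T A F x k + (A k *v v) \<bullet> yvec T A F x (Suc k)"
  using assms
  by (subst yvec.simps)
    (simp add: zvec_def inner_add_left inner_add_right inner_transpose_mult_vec
      matrix_vector_mult_add_rdistrib del: transpose_matrix_vector)

text \<open>Backward induction from \<open>T\<close>: the periods before \<open>k\<close> influence
  the remaining cost only through the center at \<open>k\<close>, which the statement therefore
  leaves unexpanded.\<close>

lemma cost_along_trajectory:
  assumes "1 \<le> k" "k \<le> T"
    and d: "\<And>t. t \<in> {k..T} \<Longrightarrow> d t = center A F c mu1 d t + L t *v u t"
  shows "(\<Sum>t = k..T. d t \<bullet> x t) = center A F c mu1 d k \<bullet> yvec T A F x k + Cval T A F c x k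
    + (\<Sum>t = k..T. u t \<bullet> (transpose (L t) *v zvec T A F x t))"
  using assms(2,1,3)
proof (induction k rule: inc_induct)
  case base
  then have "d T = center A F c mu1 d T + L T *v u T" by simp
  then have "d T \<bullet> x T = center A F c mu1 d T \<bullet> x T + u T \<bullet> (transpose (L T) *v x T)"
    by (metis inner_add_left inner_transpose_mult_vec)
  then show ?case
    by (simp add: yvec.simps[of T] Cval.simps[of T] zvec_def)
next
  case (step k)
  let ?m = "center A F c mu1 d k" and ?y = "yvec T A F x (Suc k)" and ?z = "zvec T A F x k"
  \<comment> \<open>At 0 the \<open>center\<close> recursion just returns \<open>mu1\<close>; the
    genuine update needs a nonzero period.\<close>
  have "k < T" "k \<noteq> 0" using step by auto
  have dk: "d k = ?m + L k *v u k" using step by simp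
  \<comment> \<open>Expanding the next center exposes its \<open>F k *v d k\<close> part, which
    merges with the direct cost of \<open>d k\<close> into \<open>zvec\<close>.\<close>
  have "d k \<bullet> x k + center A F c mu1 d (Suc k) \<bullet> ?y = d k \<bullet> ?z + (A k *v ?m) \<bullet> ?y + c k \<bullet> ?y"
    using \<open>k < T\<close> \<open>k \<noteq> 0\<close>
    by (simp add: zvec_def inner_add_left inner_add_right inner_transpose_mult_vec
        del: transpose_matrix_vector)
  also have "d k \<bullet> ?z = ?m \<bullet> ?z + u k \<bullet> (transpose (L k) *v ?z)"
    unfolding inner_transpose_mult_vec by (subst dk) (rule inner_add_left)
  finally have "d k \<bullet> x k + center A F c mu1 d (Suc k) \<bullet> ?y + Cval T A F c x (Suc k)
    = ?m \<bullet> yvec T A F x k + Cval T A F c x k + u k \<bullet> (transpose (L k) *v ?z)"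
    using \<open>k < T\<close> by (simp add: inner_yvec Cval.simps[of T A F c x k])
  with step show ?case
    by (simp add: sum.atLeast_Suc_atMost[of k T] del: center.simps)
qed

theorem theorem1:
  fixes T :: nat
    and x c :: "nat \<Rightarrow> real ^ 'n"
    and B :: real
    and mu1 :: "real ^ 'n"
    and A F \<Sigma> :: "nat \<Rightarrow> real ^ 'n ^ 'n"
    and L :: "nat \<Rightarrow> real ^ 'm ^ 'n"
    and r :: "nat \<Rightarrow> real"
  assumes "1 \<le> T"
    and "\<And>t. t \<in> {1..T} \<Longrightarrow> 0 \<le> r t"
    and "\<And>t. t \<in> {1..T} \<Longrightarrow> covariance_matrix (\<Sigma> t)"
    and "\<And>t. t \<in> {1..T} \<Longrightarrow> L t ** transpose (L t) = \<Sigma> t"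
  shows "(\<forall>d :: nat \<Rightarrow> real ^ 'n.
            (\<forall>t\<in>{1..T}. d t \<in> uncertainty_set A F c mu1 L r d t) \<longrightarrow>
            (\<Sum>t = 1..T. d t \<bullet> x t) \<le> B)
         \<longleftrightarrow> mu1 \<bullet> yvec T A F x 1 + Cval T A F c x 1 + Rval T A F L r x 1 \<le> B"
proof -
  define w where "w t = transpose (L t) *v zvec T A F x t" for t
  have cost: "(\<Sum>t = 1..T. d t \<bullet> x t)
      = mu1 \<bullet> yvec T A F x 1 + Cval T A F c x 1 + (\<Sum>t = 1..T. u t \<bullet> w t)"
    if "\<And>t. t \<in> {1..T} \<Longrightarrow> d t = center A F c mu1 d t + L t *v u t" for d u
    using cost_along_trajectory[OF order_refl assms(1) that] by (simp add: w_def)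
  have R: "Rval T A F L r x 1 = (\<Sum>t = 1..T. r t * norm (w t))"
    using Rval_eq_sum[OF assms(1)] by (simp add: w_def)
  show ?thesis
  proof
    assume rob: "\<forall>d. (\<forall>t\<in>{1..T}. d t \<in> uncertainty_set A F c mu1 L r d t) \<longrightarrow>
      (\<Sum>t = 1..T. d t \<bullet> x t) \<le> B"
    \<comment> \<open>If \<open>w t = 0\<close>, then \<open>r t / 0 = 0\<close> and \<open>u t = 0\<close> is still a maximizer.\<close>
    define u where "u t = (r t / norm (w t)) *\<^sub>R w t" for t
    obtain d where d: "\<And>t. d t = center A F c mu1 d t + L t *v u t"
      using exists_trajectory by metis
    \<comment> \<open>The norm is \<open>r t\<close>, or 0 if \<open>w t = 0\<close>; nonnegativity
      of the radius covers both cases.\<close>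
    have "norm (u t) \<le> r t" if "t \<in> {1..T}" for t
      using assms(2)[OF that] by (simp add: u_def)
    then have "\<forall>t\<in>{1..T}. d t \<in> uncertainty_set A F c mu1 L r d t"
      unfolding uncertainty_set_def using d by blast
    then have "(\<Sum>t = 1..T. d t \<bullet> x t) \<le> B" using rob by blast
    \<comment> \<open>Equality in Cauchy-Schwarz, as \<open>u t\<close> is a multiple of
      \<open>w t\<close>; both sides vanish if \<open>w t = 0\<close>.\<close>
    moreover have "u t \<bullet> w t = r t * norm (w t)" for t
      by (simp add: u_def dot_square_norm power2_eq_square)
    ultimately show "mu1 \<bullet> yvec T A F x 1 + Cval T A F c x 1 + Rval T A F L r x 1 \<le> B"
      using cost[OF d] R by simp
  next
    assume bound: "mu1 \<bullet> yvec T A F x 1 + Cval T A F c x 1 + Rval T A F L r x 1 \<le> B"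
    show "\<forall>d. (\<forall>t\<in>{1..T}. d t \<in> uncertainty_set A F c mu1 L r d t) \<longrightarrow>
      (\<Sum>t = 1..T. d t \<bullet> x t) \<le> B"
    proof (intro allI impI)
      fix d assume "\<forall>t\<in>{1..T}. d t \<in> uncertainty_set A F c mu1 L r d t"
      then have "\<forall>t\<in>{1..T}. \<exists>u. d t = center A F c mu1 d t + L t *v u \<and> norm u \<le> r t"
        unfolding uncertainty_set_def by blast
      then obtain u where u: "\<And>t. t \<in> {1..T} \<Longrightarrow> d t = center A F c mu1 d t + L t *v u t"
          "\<And>t. t \<in> {1..T} \<Longrightarrow> norm (u t) \<le> r t"
        by metis
      have "u t \<bullet> w t \<le> r t * norm (w t)" if "t \<in> {1..T}" for t
        using norm_cauchy_schwarz[of "u t" "w t"] mult_right_mono[OF u(2)[OF that], of "norm (w t)"]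
        by simp
      then have "(\<Sum>t = 1..T. u t \<bullet> w t) \<le> (\<Sum>t = 1..T. r t * norm (w t))"
        by (rule sum_mono)
      then show "(\<Sum>t = 1..T. d t \<bullet> x t) \<le> B"
        using cost[OF u(1)] R bound by simp
    qed
  qed
qed

end
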